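(* Let $\mathfrak I\sim\mathcal I(n,D,p)$. (a) If $D$ and $d$ are fixed integers with $1\le d\le D$ and $p=p(n)\in[0,1]$, then $f(n)=n^{-d}$ is a threshold function for the property $\mathrm{initdeg}(\mathfrak I)>d$; that is, as $n\to\infty$, $P(\mathrm{initdeg}(\mathfrak I)>d)\to1$ if $p(n)=o(n^{-d})$, and $P(\mathrm{initdeg}(\mathfrak I)>d)\to0$ if $p(n)=\omega(n^{-d})$. (b) If $n\ge1$ is fixed, $d=d(D)$ is a positive integer-valued function with $d(D)\le D$ and $\lim_{D\to\infty}d(D)=\infty$, and $p=p(D)\in[0,1]$, then $f(d)=d^{-n}$ is a threshold function for the property $\mathrm{initdeg}(\mathfrak I)>d$; that is, as $D\to\infty$, $P(\mathrm{initdeg}(\mathfrak I)>d(D))\to1$ if $p(D)=o(d(D)^{-n})$, and $P(\mathrm{initdeg}(\mathfrak I)>d(D))\to0$ if $p(D)=\omega(d(D)^{-n})$.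
   Context: Let $k$ be a field and $S=k[x_1,\dots,x_n]$. $\mathcal B(n,D,p)$ is the distribution of the random set $\mathfrak B$ of monomials of $S$ obtained by including each non-constant monomial of total degree at most $D$ independently with probability $p$. $\mathcal I(n,D,p)$ is the distribution of the random monomial ideal $\mathfrak I=(\mathfrak B)$, with $\mathfrak I=(0)$ if $\mathfrak B=\emptyset$. For a monomial ideal $I$, $\mathrm{initdeg}(I)$ is the smallest degree of a minimal generator of $I$, with $\mathrm{initdeg}((0))=+\infty$; thus $\mathrm{initdeg}(I)>d$ if and only if $I$ has no minimal generators of degree at most $d$. $f=o(g)$, equivalently $g=\omega(f)$, means $\lim f/g=0$. *)

theory Defs
  imports
    "HOL-Probability.Probability"
    "HOL-Library.Poly_Mapping"
    "HOL-Library.Extended_Nat"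
    "HOL-Library.Landau_Symbols"
    "HOL-Algebra.Ideal"
begin

text \<open>
  A monomial is identified with its exponent vector, a finitely supported function on variable
  indices. The variables of \<open>k[x\<^sub>1, \<dots>, x\<^sub>n]\<close> are indexed by \<open>{..<n}\<close>, so that \<open>n\<close> can vary inside
  a statement. Polynomials are elements of the monoid algebra of all monomials over the field.
\<close>

type_synonym monomial = "nat \<Rightarrow>\<^sub>0 nat"
type_synonym 'k mpoly = "monomial \<Rightarrow>\<^sub>0 'k"

definition monomials :: "nat \<Rightarrow> monomial set" where
  "monomials n = {m. Poly_Mapping.keys m \<subseteq> {..<n}}"

definition mdeg :: "monomial \<Rightarrow> nat" where
  "mdeg m = (\<Sum>i\<in>Poly_Mapping.keys m. Poly_Mapping.lookup m i)"

definition monom_poly :: "monomial \<Rightarrow> 'k::field mpoly" where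
  "monom_poly m = Poly_Mapping.single m 1"

definition poly_ring :: "nat \<Rightarrow> 'k::field mpoly ring" where
  "poly_ring n = \<lparr>carrier = {f. Poly_Mapping.keys f \<subseteq> monomials n},
                  mult = (*), one = 1, zero = 0, add = (+)\<rparr>"

lemma cring_poly_ring: "cring (poly_ring n :: 'k::field mpoly ring)"
proof (rule cringI)
  have add: "f + g \<in> carrier (poly_ring n)"
    if "f \<in> carrier (poly_ring n)" "g \<in> carrier (poly_ring n)" for f g :: "'k mpoly"
    using that Poly_Mapping.keys_add[of f g] by (auto simp: poly_ring_def)
  have neg: "- f \<in> carrier (poly_ring n)" if "f \<in> carrier (poly_ring n)" for f :: "'k mpoly"
    using that by (auto simp: poly_ring_def in_keys_iff subset_iff)
  have mon: "a + b \<in> monomials n" if "a \<in> monomials n" "b \<in> monomials n" for a b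
    using that Poly_Mapping.keys_add[of a b] by (auto simp: monomials_def)
  have mult: "f * g \<in> carrier (poly_ring n)"
    if "f \<in> carrier (poly_ring n)" "g \<in> carrier (poly_ring n)" for f g :: "'k mpoly"
  proof -
    have "k \<in> monomials n" if "k \<in> Poly_Mapping.keys (f * g)" for k
    proof -
      obtain a b where "k = a + b" "a \<in> Poly_Mapping.keys f" "b \<in> Poly_Mapping.keys g"
        using \<open>k \<in> _\<close> keys_mult[of f g] by blast
      with \<open>f \<in> _\<close> \<open>g \<in> _\<close> show ?thesis by (auto simp: poly_ring_def intro: mon)
    qed
    then show ?thesis by (auto simp: poly_ring_def)
  qed
  show "abelian_group (poly_ring n :: 'k mpoly ring)"
  proof (rule abelian_groupI)
    fix x :: "'k mpoly" assume "x \<in> carrier (poly_ring n)"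
    then show "\<exists>y\<in>carrier (poly_ring n). y \<oplus>\<^bsub>poly_ring n\<^esub> x = \<zero>\<^bsub>poly_ring n\<^esub>"
      using neg by (intro bexI[of _ "- x"]) (auto simp: poly_ring_def)
  qed (use add in \<open>auto simp: poly_ring_def algebra_simps\<close>)
  show "Group.comm_monoid (poly_ring n :: 'k mpoly ring)"
    by (rule comm_monoidI)
      (use mult in \<open>auto simp: poly_ring_def monomials_def algebra_simps\<close>)
qed (auto simp: poly_ring_def algebra_simps)

text \<open>By the convention of \<^const>\<open>genideal\<close>, the empty set generates the zero ideal.\<close>

definition monomial_ideal :: "nat \<Rightarrow> monomial set \<Rightarrow> 'k::field mpoly set" where
  "monomial_ideal n B = genideal (poly_ring n) (monom_poly ` B)"

definition minimal_generating_set :: "nat \<Rightarrow> 'k::field mpoly set \<Rightarrow> monomial set \<Rightarrow> bool" where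
  "minimal_generating_set n I G \<longleftrightarrow>
     G \<subseteq> monomials n \<and> monomial_ideal n G = I \<and> (\<forall>H. H \<subset> G \<longrightarrow> monomial_ideal n H \<noteq> I)"

text \<open>
  A monomial ideal has exactly one minimal generating set of monomials; its elements are
  the minimal generators.
\<close>

definition minimal_generators :: "nat \<Rightarrow> 'k::field mpoly set \<Rightarrow> monomial set" where
  "minimal_generators n I = {m. \<exists>G. minimal_generating_set n I G \<and> m \<in> G}"

text \<open>The zero ideal has no minimal generators, and the infimum of the empty set is \<open>\<infinity>\<close>.\<close>

definition initdeg :: "nat \<Rightarrow> 'k::field mpoly set \<Rightarrow> enat" where
  "initdeg n I = (INF m\<in>minimal_generators n I. enat (mdeg m))"

definition candidate_monomials :: "nat \<Rightarrow> nat \<Rightarrow> monomial set" where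
  "candidate_monomials n D = {m \<in> monomials n. m \<noteq> 0 \<and> mdeg m \<le> D}"

text \<open>Finiteness matters because \<^const>\<open>Pi_pmf\<close> is only meaningful over a finite index set.\<close>

lemma finite_candidate_monomials: "finite (candidate_monomials n D)"
proof (rule finite_imageD)
  let ?F = "{f. \<forall>i. (i \<in> {..<n} \<longrightarrow> f i \<in> {..D}) \<and> (i \<notin> {..<n} \<longrightarrow> f i = (0::nat))}"
  have "Poly_Mapping.lookup m i \<le> D" if "m \<in> candidate_monomials n D" for m i
  proof (cases "i \<in> Poly_Mapping.keys m")
    case True
    then have "Poly_Mapping.lookup m i \<le> mdeg m"
      unfolding mdeg_def by (intro member_le_sum) auto
    with that show ?thesis by (simp add: candidate_monomials_def)
  qed (simp add: in_keys_iff)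
  moreover have "Poly_Mapping.lookup m i = 0"
    if "m \<in> candidate_monomials n D" "i \<notin> {..<n}" for m i
    using that unfolding candidate_monomials_def monomials_def
    by (metis (no_types, lifting) in_keys_iff mem_Collect_eq subsetD)
  ultimately have "Poly_Mapping.lookup ` candidate_monomials n D \<subseteq> ?F"
    by auto
  moreover have "finite ?F" by (rule finite_set_of_finite_funs) auto
  ultimately show "finite (Poly_Mapping.lookup ` candidate_monomials n D)"
    by (rule finite_subset)
  show "inj_on Poly_Mapping.lookup (candidate_monomials n D)"
    by (rule inj_onI) (simp add: lookup_inject)
qed

definition random_monomials :: "nat \<Rightarrow> nat \<Rightarrow> real \<Rightarrow> monomial set pmf" where
  "random_monomials n D p =
     map_pmf (\<lambda>X. {m \<in> candidate_monomials n D. X m})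
       (Pi_pmf (candidate_monomials n D) False (\<lambda>_. bernoulli_pmf p))"

definition random_monomial_ideal :: "nat \<Rightarrow> nat \<Rightarrow> real \<Rightarrow> 'k::field mpoly set pmf" where
  "random_monomial_ideal n D p = map_pmf (monomial_ideal n) (random_monomials n D p)"

end

theory Submission
  imports Defs
begin

text \<open>
  The random ideal has initial degree greater than \<open>d\<close> exactly when none of the \<open>N\<close> non-constant
  monomials of degree at most \<open>d\<close> was drawn: a drawn monomial need not be a minimal generator, but
  it is a multiple of one, of no larger degree; conversely every monomial in the ideal is a multiple
  of a drawn one (\<open>initdeg_monomial_ideal_greater_iff\<close>). The draws are independent, so the probability
  in question is exactly \<open>(1 - p) ^ N\<close> (\<open>prob_initdeg_greater\<close>), and the algebra is finished.

  The number \<open>N\<close> is \<open>((n + d) choose n) - 1\<close> (\<open>card_candidate_monomials\<close>). This expression is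
  symmetric in \<open>n\<close> and \<open>d\<close>; when one of the two is a fixed positive integer \<open>j\<close> and the other one,
  \<open>m\<close>, grows, it has order \<open>m ^ j\<close> (\<open>binomial_minus_1_bigtheta\<close>). The single estimate therefore
  yields the order \<open>n ^ d\<close> for fixed \<open>d\<close> and the order \<open>d ^ n\<close> for fixed \<open>n\<close>.

  Finally \<open>1 - N * p \<le> (1 - p) ^ N \<le> exp (- (N * p))\<close>, so the probability tends to 1 when
  \<open>N * p\<close> tends to 0, and to 0 when \<open>N * p\<close> tends to infinity. If \<open>N\<close> has order \<open>g\<close>, these are the
  cases \<open>p = o(1 / g)\<close> and \<open>p = \<omega>(1 / g)\<close>, which makes \<open>1 / g\<close> a threshold function
  (\<open>initdeg_threshold\<close>).
\<close>

section \<open>Divisibility and degree of monomials\<close>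

definition divides :: "monomial \<Rightarrow> monomial \<Rightarrow> bool" where
  "divides b m \<longleftrightarrow> (\<exists>c. m = b + c)"

lemma divides_refl: "divides m m"
  unfolding divides_def by (rule exI[of _ 0]) simp

lemma divides_trans: "divides a b \<Longrightarrow> divides b c \<Longrightarrow> divides a c"
  unfolding divides_def by (metis add.assoc)

lemma mdeg_eq_sum:
  assumes "finite A" "Poly_Mapping.keys m \<subseteq> A"
  shows "mdeg m = (\<Sum>i\<in>A. Poly_Mapping.lookup m i)"
  unfolding mdeg_def using assms by (intro sum.mono_neutral_left) (auto simp: in_keys_iff)

lemma mdeg_add: "mdeg (a + b) = mdeg a + mdeg b"
proof -
  let ?A = "Poly_Mapping.keys a \<union> Poly_Mapping.keys b"
  have "mdeg (a + b) = (\<Sum>i\<in>?A. Poly_Mapping.lookup (a + b) i)"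
    using Poly_Mapping.keys_add[of a b] by (intro mdeg_eq_sum) auto
  also have "\<dots> = mdeg a + mdeg b"
    by (simp add: lookup_add sum.distrib mdeg_eq_sum[of ?A a] mdeg_eq_sum[of ?A b])
  finally show ?thesis .
qed

lemma mdeg_eq_0_iff: "mdeg m = 0 \<longleftrightarrow> m = 0"
proof
  assume "mdeg m = 0"
  then have "Poly_Mapping.lookup m i = 0" for i
    by (cases "i \<in> Poly_Mapping.keys m") (auto simp: mdeg_def in_keys_iff)
  then show "m = 0" by (intro poly_mapping_eqI) simp
qed (simp add: mdeg_def)

lemma divides_imp_mdeg_le: "divides b m \<Longrightarrow> mdeg b \<le> mdeg m"
  by (auto simp: divides_def mdeg_add)

lemma divides_imp_mdeg_less: "divides b m \<Longrightarrow> b \<noteq> m \<Longrightarrow> mdeg b < mdeg m"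
  by (auto simp: divides_def mdeg_add) (metis add.right_neutral mdeg_eq_0_iff neq0_conv)

lemma monomials_cofactor: "b + c \<in> monomials n \<Longrightarrow> c \<in> monomials n"
  by (auto simp: monomials_def in_keys_iff lookup_add subset_iff)

section \<open>Ideal membership and initial degree\<close>

lemma keys_monom_poly [simp]: "Poly_Mapping.keys (monom_poly m :: 'k::field mpoly) = {m}"
  by (simp add: monom_poly_def)

lemma monom_poly_in_carrier:
  "B \<subseteq> monomials n \<Longrightarrow> monom_poly ` B \<subseteq> carrier (poly_ring n :: 'k::field mpoly ring)"
  by (auto simp: poly_ring_def)

text \<open>
  Every term of a product \<open>g * f\<close> is a multiple of a term of \<open>f\<close>. So the polynomials all of whose
  terms are multiples of elements of \<open>B\<close> form an ideal, which serves as an upper bound for the ideal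
  generated by \<open>B\<close>.
\<close>

lemma ideal_of_divisible_support:
  "ideal {f :: 'k::field mpoly. Poly_Mapping.keys f \<subseteq> {m \<in> monomials n. \<exists>b\<in>B. divides b m}}
     (poly_ring n)" (is "ideal ?J ?R")
proof -
  interpret cring ?R by (rule cring_poly_ring)
  have closed: "g * f \<in> ?J" if f: "f \<in> ?J" and g: "g \<in> carrier ?R" for f g
  proof -
    have "k \<in> monomials n \<and> (\<exists>b\<in>B. divides b k)" if k: "k \<in> Poly_Mapping.keys (g * f)" for k
    proof -
      obtain c m where km: "k = c + m" "c \<in> Poly_Mapping.keys g" "m \<in> Poly_Mapping.keys f"
        using k keys_mult[of g f] by blast
      then obtain b where b: "b \<in> B" "divides b m" using f by auto
      have "divides m k" unfolding divides_def km by (metis add.commute)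
      moreover have "k \<in> monomials n"
        using km f g Poly_Mapping.keys_add[of c m] by (fastforce simp: poly_ring_def monomials_def)
      ultimately show ?thesis using b divides_trans by blast
    qed
    then show ?thesis by auto
  qed
  show ?thesis
  proof (rule idealI)
    show "ring ?R" by (rule ring_axioms)
    show "subgroup ?J (add_monoid ?R)"
    proof (rule group.subgroupI)
      show "Group.group (add_monoid ?R)" by (rule a_group)
      show "?J \<subseteq> carrier (add_monoid ?R)" by (auto simp: poly_ring_def)
      show "?J \<noteq> {}" by (auto intro: exI[of _ 0])
      show "inv\<^bsub>add_monoid ?R\<^esub> f \<in> ?J" if "f \<in> ?J" for f
      proof -
        have "\<ominus>\<^bsub>?R\<^esub> f = - f"
          using that by (intro minus_equality) (auto simp: poly_ring_def in_keys_iff subset_iff)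
        then show ?thesis using that by (auto simp: a_inv_def in_keys_iff subset_iff)
      qed
      show "f \<otimes>\<^bsub>add_monoid ?R\<^esub> g \<in> ?J" if "f \<in> ?J" "g \<in> ?J" for f g
        using that Poly_Mapping.keys_add[of f g] by (auto simp: poly_ring_def)
    qed
    show "x \<otimes>\<^bsub>?R\<^esub> a \<in> ?J" if "a \<in> ?J" "x \<in> carrier ?R" for a x
      using closed[OF that] by (simp add: poly_ring_def)
    show "a \<otimes>\<^bsub>?R\<^esub> x \<in> ?J" if "a \<in> ?J" "x \<in> carrier ?R" for a x
      using closed[OF that] by (simp add: poly_ring_def mult.commute)
  qed
qed

text \<open>
  This reduces all questions about monomial ideals that arise here to divisibility of exponent
  vectors; the coefficient field disappears from the argument.
\<close>

lemma monom_poly_in_monomial_ideal_iff: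
  assumes B: "B \<subseteq> monomials n" and m: "m \<in> monomials n"
  shows "(monom_poly m :: 'k::field mpoly) \<in> monomial_ideal n B \<longleftrightarrow> (\<exists>b\<in>B. divides b m)"
proof -
  interpret cring "poly_ring n :: 'k mpoly ring" by (rule cring_poly_ring)
  note carr = monom_poly_in_carrier[OF B]
  show ?thesis
  proof
    assume "(monom_poly m :: 'k mpoly) \<in> monomial_ideal n B"
    moreover have "(monomial_ideal n B :: 'k mpoly set) \<subseteq>
        {f. Poly_Mapping.keys f \<subseteq> {m \<in> monomials n. \<exists>b\<in>B. divides b m}}"
      unfolding monomial_ideal_def
      using B by (intro genideal_minimal ideal_of_divisible_support) (auto intro: divides_refl)
    ultimately show "\<exists>b\<in>B. divides b m" by fastforce
  next
    assume "\<exists>b\<in>B. divides b m"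
    then obtain b c where b: "b \<in> B" and c: "m = b + c" by (auto simp: divides_def)
    have "(monom_poly b :: 'k mpoly) \<in> monomial_ideal n B"
      using genideal_self[OF carr] b by (auto simp: monomial_ideal_def)
    moreover have "(monom_poly c :: 'k mpoly) \<in> carrier (poly_ring n)"
      using monomials_cofactor m c by (auto simp: poly_ring_def)
    ultimately have "(monom_poly b * monom_poly c :: 'k mpoly) \<in> monomial_ideal n B"
      using ideal.I_r_closed[OF genideal_ideal[OF carr]]
      by (force simp: monomial_ideal_def poly_ring_def)
    then show "(monom_poly m :: 'k mpoly) \<in> monomial_ideal n B"
      by (simp add: monom_poly_def mult_single c)
  qed
qed

definition minimal_elements :: "monomial set \<Rightarrow> monomial set" where
  "minimal_elements B = {g \<in> B. \<forall>b\<in>B. divides b g \<longrightarrow> b = g}"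

text \<open>
  Proper divisors have strictly smaller degree, so descent to divisors inside \<open>B\<close> ends even if \<open>B\<close>
  is infinite.
\<close>

lemma ex_minimal_divisor:
  assumes "b \<in> B"
  shows "\<exists>g\<in>minimal_elements B. divides g b"
  using assms
proof (induction "mdeg b" arbitrary: b rule: less_induct)
  case less
  show ?case
  proof (cases "b \<in> minimal_elements B")
    case False
    then obtain b' where "b' \<in> B" "divides b' b" "b' \<noteq> b"
      using less.prems by (auto simp: minimal_elements_def)
    then show ?thesis using less.hyps divides_imp_mdeg_less divides_trans by blast
  qed (auto intro: divides_refl)
qed

text \<open>
  The minimal elements generate because each element of \<open>B\<close> is a multiple of one of them. None can
  be dropped: a minimal element \<open>g\<close> in the ideal generated by the others would be a multiple of one
  of them, against its minimality.
\<close>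

lemma minimal_generating_set_minimal_elements:
  assumes B: "B \<subseteq> monomials n"
  shows "minimal_generating_set n (monomial_ideal n B :: 'k::field mpoly set) (minimal_elements B)"
  unfolding minimal_generating_set_def
proof (intro conjI allI impI)
  let ?G = "minimal_elements B"
  interpret cring "poly_ring n :: 'k mpoly ring" by (rule cring_poly_ring)
  show G: "?G \<subseteq> monomials n" using B by (auto simp: minimal_elements_def)
  show "(monomial_ideal n ?G :: 'k mpoly set) = monomial_ideal n B"
  proof
    have "(monom_poly b :: 'k mpoly) \<in> monomial_ideal n ?G" if "b \<in> B" for b
      using that B ex_minimal_divisor[OF that] monom_poly_in_monomial_ideal_iff[OF G] by blast
    then show "(monomial_ideal n B :: 'k mpoly set) \<subseteq> monomial_ideal n ?G"
      unfolding monomial_ideal_def[of n B]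
      using genideal_ideal[OF monom_poly_in_carrier[OF G]]
      by (intro genideal_minimal) (auto simp: monomial_ideal_def)
    have "(monom_poly ` ?G :: 'k mpoly set) \<subseteq> monomial_ideal n B"
      using genideal_self[OF monom_poly_in_carrier[OF B]]
      by (auto simp: monomial_ideal_def minimal_elements_def)
    then show "(monomial_ideal n ?G :: 'k mpoly set) \<subseteq> monomial_ideal n B"
      unfolding monomial_ideal_def[of n ?G]
      using genideal_ideal[OF monom_poly_in_carrier[OF B]]
      by (intro genideal_minimal) (auto simp: monomial_ideal_def)
  qed
  show "(monomial_ideal n H :: 'k mpoly set) \<noteq> monomial_ideal n B" if H: "H \<subset> ?G" for H
  proof
    assume eq: "(monomial_ideal n H :: 'k mpoly set) = monomial_ideal n B"
    from H obtain g where g: "g \<in> ?G" "g \<notin> H" by auto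
    then have gB: "g \<in> B" by (simp add: minimal_elements_def)
    then have "(monom_poly g :: 'k mpoly) \<in> monomial_ideal n H"
      unfolding eq using B monom_poly_in_monomial_ideal_iff[OF B] divides_refl by blast
    then obtain h where "h \<in> H" "divides h g"
      using gB B H G monom_poly_in_monomial_ideal_iff[of H n g] by blast
    then show False using g H by (auto simp: minimal_elements_def)
  qed
qed

lemma initdeg_greater_iff:
  fixes I :: "'k::field mpoly set"
  shows "initdeg n I > enat d \<longleftrightarrow> (\<forall>m\<in>minimal_generators n I. d < mdeg m)"
proof -
  have "initdeg n I > enat d \<longleftrightarrow> eSuc (enat d) \<le> initdeg n I"
    by (simp add: ileI1 ile0_eq iless_Suc_eq eSuc_enat Suc_ile_eq)
  also have "\<dots> \<longleftrightarrow> (\<forall>m\<in>minimal_generators n I. d < mdeg m)"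
    unfolding initdeg_def by (simp add: le_INF_iff eSuc_enat Suc_le_eq)
  finally show ?thesis .
qed

text \<open>
  The generating set \<open>B\<close> is compared with the minimal generators without identifying the latter:
  every element of \<open>B\<close> is a multiple of some minimal generator, and, since minimal generators lie in
  the ideal, every minimal generator is a multiple of some element of \<open>B\<close>. Degrees only grow under
  multiplication, so the smallest degree is the same on both sides.
\<close>

lemma initdeg_monomial_ideal_greater_iff:
  assumes B: "B \<subseteq> monomials n"
  shows "initdeg n (monomial_ideal n B :: 'k::field mpoly set) > enat d \<longleftrightarrow> (\<forall>b\<in>B. d < mdeg b)"
  unfolding initdeg_greater_iff
proof
  assume all: "\<forall>m\<in>minimal_generators n (monomial_ideal n B :: 'k mpoly set). d < mdeg m"
  show "\<forall>b\<in>B. d < mdeg b"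
  proof
    fix b assume "b \<in> B"
    then obtain g where g: "g \<in> minimal_elements B" "divides g b"
      using ex_minimal_divisor by blast
    then have "g \<in> minimal_generators n (monomial_ideal n B :: 'k mpoly set)"
      using minimal_generating_set_minimal_elements[OF B] by (auto simp: minimal_generators_def)
    then have "d < mdeg g" using all by blast
    also have "mdeg g \<le> mdeg b" using g by (intro divides_imp_mdeg_le)
    finally show "d < mdeg b" .
  qed
next
  assume all: "\<forall>b\<in>B. d < mdeg b"
  show "\<forall>m\<in>minimal_generators n (monomial_ideal n B :: 'k mpoly set). d < mdeg m"
  proof
    fix m assume "m \<in> minimal_generators n (monomial_ideal n B :: 'k mpoly set)"
    then obtain H where H: "H \<subseteq> monomials n" "m \<in> H"
      and eq: "(monomial_ideal n H :: 'k mpoly set) = monomial_ideal n B"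
      by (auto simp: minimal_generators_def minimal_generating_set_def)
    have "(monom_poly m :: 'k mpoly) \<in> monomial_ideal n B"
      unfolding eq[symmetric] using H monom_poly_in_monomial_ideal_iff[OF H(1)] divides_refl by blast
    then obtain b where "b \<in> B" "divides b m"
      using H B monom_poly_in_monomial_ideal_iff[OF B] by blast
    then show "d < mdeg m" using all divides_imp_mdeg_le[of b m] by fastforce
  qed
qed

section \<open>The probability that no generator has low degree\<close>

text \<open>
  The event is a product event for the independent indicators: those of monomials of degree at most
  \<open>d\<close> must be false and the others, of degree between \<open>d + 1\<close> and \<open>D\<close>, are unconstrained and
  contribute the factor 1.
\<close>

lemma prob_initdeg_greater:
  assumes "d \<le> D" "p \<in> {0..1}"
  shows "measure_pmf.prob (random_monomial_ideal n D p :: 'k::field mpoly set pmf)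
           {I. initdeg n I > enat d} = (1 - p) ^ card (candidate_monomials n d)"
proof -
  let ?C = "candidate_monomials n D" and ?c = "candidate_monomials n d"
  let ?A = "\<lambda>m. if m \<in> ?c then {False} else UNIV"
  have sub: "?c \<subseteq> ?C" using assms by (auto simp: candidate_monomials_def)
  have "(initdeg n (monomial_ideal n {m \<in> ?C. X m} :: 'k mpoly set) > enat d) \<longleftrightarrow> X \<in> Pi ?C ?A" for X
  proof -
    have "{m \<in> ?C. X m} \<subseteq> monomials n" by (auto simp: candidate_monomials_def)
    note initdeg_monomial_ideal_greater_iff[OF this, of d, where ?'k = 'k]
    also have "(\<forall>m\<in>{m \<in> ?C. X m}. d < mdeg m) \<longleftrightarrow> X \<in> Pi ?C ?A"
      using assms(1) by (auto simp: Pi_def candidate_monomials_def not_le)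
    finally show ?thesis .
  qed
  then have "measure_pmf.prob (random_monomial_ideal n D p :: 'k mpoly set pmf)
      {I. initdeg n I > enat d} =
      measure_pmf.prob (Pi_pmf ?C False (\<lambda>_. bernoulli_pmf p)) (Pi ?C ?A)"
    by (simp add: random_monomial_ideal_def random_monomials_def vimage_def)
  also have "\<dots> = (\<Prod>m\<in>?C. measure_pmf.prob (bernoulli_pmf p) (?A m))"
    by (rule measure_Pi_pmf_Pi) (rule finite_candidate_monomials)
  also have "\<dots> = (\<Prod>m\<in>?c. 1 - p)"
    using sub assms by (intro prod.mono_neutral_cong_right finite_candidate_monomials)
      (auto simp: measure_pmf_single)
  finally show ?thesis by simp
qed

section \<open>Counting monomials of bounded degree\<close>

text \<open>
  A slack variable turns the bound into an equation: appending \<open>d - mdeg m\<close> to the exponents of \<open>m\<close>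
  gives a list of \<open>n + 1\<close> natural numbers with sum \<open>d\<close>, and such lists are counted by stars and bars.
\<close>

lemma card_monomials_mdeg_le: "card {m \<in> monomials n. mdeg m \<le> d} = (n + d) choose n"
proof -
  let ?M = "{m \<in> monomials n. mdeg m \<le> d}"
  let ?L = "{l :: nat list. length l = Suc n \<and> sum_list l = d}"
  let ?f = "\<lambda>m. map (Poly_Mapping.lookup m) [0..<n] @ [d - mdeg m]"
  have deg: "mdeg m = sum_list (map (Poly_Mapping.lookup m) [0..<n])" if "m \<in> monomials n" for m
    using that by (simp add: mdeg_eq_sum[of "{..<n}"] monomials_def interv_sum_list_conv_sum_set_nat
      atLeast0LessThan)
  have "bij_betw ?f ?M ?L"
    unfolding bij_betw_def
  proof
    show "inj_on ?f ?M"
    proof (rule inj_onI, rule poly_mapping_eqI)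
      fix a b i assume ab: "a \<in> ?M" "b \<in> ?M" "?f a = ?f b"
      show "Poly_Mapping.lookup a i = Poly_Mapping.lookup b i"
      proof (cases "i < n")
        case False
        then have "i \<notin> Poly_Mapping.keys a" "i \<notin> Poly_Mapping.keys b"
          using ab by (auto simp: monomials_def)
        then show ?thesis by (simp add: in_keys_iff)
      qed (use ab in \<open>simp add: map_eq_conv\<close>)
    qed
    show "?f ` ?M = ?L"
    proof (intro equalityI subsetI)
      fix l assume "l \<in> ?f ` ?M"
      then show "l \<in> ?L" by (auto simp: deg)
    next
      fix l assume l: "l \<in> ?L"
      then obtain xs x where lx: "l = xs @ [x]" "length xs = n" "sum_list xs + x = d"
        by (cases l rule: rev_cases) auto
      define m where "m = Poly_Mapping.nth xs"
      have look: "map (Poly_Mapping.lookup m) [0..<n] = xs"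
        using lx by (intro nth_equalityI) (auto simp: m_def nth.rep_eq nth_default_def)
      have mem: "m \<in> monomials n"
        using lx by (auto simp: m_def monomials_def in_keys_iff nth.rep_eq nth_default_def
          simp del: keys_nth split: if_splits)
      have "mdeg m = sum_list xs" using deg[OF mem] look by simp
      then show "l \<in> ?f ` ?M" using lx mem look by (intro image_eqI[of _ _ m]) auto
    qed
  qed
  then have "card ?M = card ?L" by (rule bij_betw_same_card)
  also have "\<dots> = (n + d) choose n"
    by (simp add: card_length_sum_list add.commute binomial_symmetric[of d "d + n"])
  finally show ?thesis .
qed

lemma card_candidate_monomials: "card (candidate_monomials n d) = ((n + d) choose n) - 1"
proof -
  have "candidate_monomials n d = {m \<in> monomials n. mdeg m \<le> d} - {0}"
    by (auto simp: candidate_monomials_def)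
  moreover have "0 \<in> {m \<in> monomials n. mdeg m \<le> d}"
    by (simp add: monomials_def mdeg_def)
  ultimately show ?thesis using card_monomials_mdeg_le by (simp add: card_Diff_singleton)
qed

text \<open>
  The bounds \<open>((m + j) / j) ^ j \<le> ((m + j) choose j) \<le> (m + j) ^ j\<close> give the order. Subtracting 1
  costs at most a factor 2, because the binomial coefficient is at least 2 when \<open>m\<close> and \<open>j\<close> are
  positive.
\<close>

lemma binomial_minus_1_bigtheta:
  assumes "1 \<le> j"
  shows "(\<lambda>m. real (((m + j) choose j) - 1)) \<in> \<Theta>(\<lambda>m. real m ^ j)"
proof (rule bigthetaI)
  show "(\<lambda>m. real (((m + j) choose j) - 1)) \<in> O(\<lambda>m. real m ^ j)"
  proof (rule bigoI[where c = "real (1 + j) ^ j"], rule eventually_sequentiallyI[of 1])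
    fix m :: nat assume "1 \<le> m"
    have "((m + j) choose j) - 1 \<le> (m + j) ^ j"
      using binomial_le_pow[of j "m + j"] by simp
    also have "\<dots> \<le> ((1 + j) * m) ^ j"
      using \<open>1 \<le> m\<close> by (intro power_mono) (auto simp: algebra_simps)
    finally have "real (((m + j) choose j) - 1) \<le> real (((1 + j) * m) ^ j)"
      by (rule of_nat_mono)
    then show "norm (real (((m + j) choose j) - 1)) \<le> real (1 + j) ^ j * norm (real m ^ j)"
      by (simp only: of_nat_power of_nat_mult power_mult_distrib real_norm_def abs_of_nat power_abs)
  qed
  show "(\<lambda>m. real (((m + j) choose j) - 1)) \<in> \<Omega>(\<lambda>m. real m ^ j)"
  proof (rule landau_omega.bigI[where c = "1 / (2 * real j ^ j)"], use assms in simp,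
      rule eventually_sequentiallyI[of 1])
    fix m :: nat assume "1 \<le> m"
    have "j + 1 \<le> (m + j) choose j"
      using binomial_right_mono[of "j + 1" "m + j" j] \<open>1 \<le> m\<close> by simp
    then have two: "real ((m + j) choose j) \<le> 2 * real (((m + j) choose j) - 1)"
      using assms by linarith
    have "(real m / real j) ^ j \<le> (real (m + j) / real j) ^ j"
      by (intro power_mono divide_right_mono) auto
    also have "\<dots> \<le> real ((m + j) choose j)"
      by (rule binomial_ge_n_over_k_pow_k) simp
    finally have "(real m / real j) ^ j \<le> 2 * real (((m + j) choose j) - 1)" using two by simp
    then show "1 / (2 * real j ^ j) * norm (real m ^ j) \<le> norm (real (((m + j) choose j) - 1))"
      by (simp add: power_divide)
  qed
qed

section \<open>The limit of the probability of no success\<close>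

text \<open>
  The power is squeezed between \<open>1 - N * p\<close> and 1. The lower bound is Bernoulli's inequality, which
  here expresses the union bound over the \<open>N x\<close> trials.
\<close>

lemma power_tendsto_1_below_threshold:
  fixes p g :: "'a \<Rightarrow> real" and N :: "'a \<Rightarrow> nat"
  assumes p: "eventually (\<lambda>x. p x \<in> {0..1}) F" and g: "eventually (\<lambda>x. g x \<noteq> 0) F"
    and N: "(\<lambda>x. real (N x)) \<in> O[F](g)" and small: "p \<in> o[F](\<lambda>x. 1 / g x)"
  shows "((\<lambda>x. (1 - p x) ^ N x) \<longlongrightarrow> 1) F"
proof (rule tendsto_sandwich)
  have "(\<lambda>x. real (N x) * p x) \<in> o[F](\<lambda>x. g x * (1 / g x))"
    by (rule landau_o.big_small_mult[OF N small])
  also have "(\<lambda>x. g x * (1 / g x)) \<in> \<Theta>[F](\<lambda>_. 1)"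
    using g by (intro bigthetaI_cong) (auto elim: eventually_mono)
  finally have "((\<lambda>x. real (N x) * p x) \<longlongrightarrow> 0) F" by (auto dest: smalloD_tendsto)
  from tendsto_diff[OF tendsto_const[of 1] this]
  show "((\<lambda>x. 1 - real (N x) * p x) \<longlongrightarrow> 1) F" by simp
  show "eventually (\<lambda>x. 1 - real (N x) * p x \<le> (1 - p x) ^ N x) F"
    using p
  proof eventually_elim
    case (elim x)
    then show ?case using Bernoulli_inequality[of "- p x" "N x"] by simp
  qed
  show "eventually (\<lambda>x. (1 - p x) ^ N x \<le> 1) F"
    using p by eventually_elim (auto intro: power_le_one)
qed simp

text \<open>
  The bound \<open>1 - p \<le> exp (- p)\<close>, raised to the power \<open>N\<close>, takes the place of a second moment
  argument, thanks to the independence of the trials.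
\<close>

lemma power_tendsto_0_above_threshold:
  fixes p g :: "'a \<Rightarrow> real" and N :: "'a \<Rightarrow> nat"
  assumes p: "eventually (\<lambda>x. p x \<in> {0..1}) F" and g: "eventually (\<lambda>x. g x \<noteq> 0) F"
    and N: "(\<lambda>x. real (N x)) \<in> \<Omega>[F](g)" and large: "p \<in> \<omega>[F](\<lambda>x. 1 / g x)"
  shows "((\<lambda>x. (1 - p x) ^ N x) \<longlongrightarrow> 0) F"
proof (rule tendsto_sandwich[where f = "\<lambda>_. 0"])
  have "(\<lambda>x. real (N x) * p x) \<in> \<omega>[F](\<lambda>x. g x * (1 / g x))"
    by (rule landau_omega.big_small_mult[OF N large])
  also have "(\<lambda>x. g x * (1 / g x)) \<in> \<Theta>[F](\<lambda>_. 1)"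
    using g by (intro bigthetaI_cong) (auto elim: eventually_mono)
  finally have "filterlim (\<lambda>x. norm (real (N x) * p x)) at_top F"
    by (simp only: smallomega_1_conv_filterlim filterlim_at_infinity_conv_norm_at_top)
  then have "filterlim (\<lambda>x. real (N x) * p x) at_top F"
    by (rule filterlim_at_top_mono) (use p in eventually_elim, auto simp: abs_mult)
  then show "((\<lambda>x. exp (- (real (N x) * p x))) \<longlongrightarrow> 0) F"
    by (intro filterlim_compose[OF exp_at_bot]) (simp add: filterlim_uminus_at_bot)
  show "eventually (\<lambda>x. (1 - p x) ^ N x \<le> exp (- (real (N x) * p x))) F"
    using p
  proof eventually_elim
    case (elim x)
    have "(1 - p x) ^ N x \<le> exp (- p x) ^ N x"
      using elim exp_ge_add_one_self[of "- p x"] by (intro power_mono) auto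
    then show ?case by (simp add: exp_of_nat_mult[symmetric])
  qed
  show "eventually (\<lambda>x. 0 \<le> (1 - p x) ^ N x) F"
    using p by eventually_elim auto
qed simp

text \<open>
  All three parameters may vary with \<open>x\<close>, so that fixing either the number of variables or the
  degree is a special case. The threshold is the reciprocal of the order \<open>g\<close> of the number of
  monomials that must be avoided.
\<close>

lemma initdeg_threshold:
  fixes n d D :: "nat \<Rightarrow> nat" and p g :: "nat \<Rightarrow> real"
  assumes dD: "eventually (\<lambda>x. d x \<le> D x) at_top"
    and p: "eventually (\<lambda>x. p x \<in> {0..1}) at_top" and g: "eventually (\<lambda>x. g x \<noteq> 0) at_top"
    and N: "(\<lambda>x. real (((n x + d x) choose n x) - 1)) \<in> \<Theta>(g)"
  shows "p \<in> o(\<lambda>x. 1 / g x) \<Longrightarrow>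
      (\<lambda>x. measure_pmf.prob (random_monomial_ideal (n x) (D x) (p x) :: 'k::field mpoly set pmf)
             {I. initdeg (n x) I > enat (d x)}) \<longlonglongrightarrow> 1"
    and "p \<in> \<omega>(\<lambda>x. 1 / g x) \<Longrightarrow>
      (\<lambda>x. measure_pmf.prob (random_monomial_ideal (n x) (D x) (p x) :: 'k mpoly set pmf)
             {I. initdeg (n x) I > enat (d x)}) \<longlonglongrightarrow> 0"
proof -
  have eq: "eventually (\<lambda>x. (1 - p x) ^ (((n x + d x) choose n x) - 1) =
      measure_pmf.prob (random_monomial_ideal (n x) (D x) (p x) :: 'k mpoly set pmf)
        {I. initdeg (n x) I > enat (d x)}) at_top"
    using dD p by eventually_elim (simp add: prob_initdeg_greater card_candidate_monomials)
  show "(\<lambda>x. measure_pmf.prob (random_monomial_ideal (n x) (D x) (p x) :: 'k mpoly set pmf)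
      {I. initdeg (n x) I > enat (d x)}) \<longlonglongrightarrow> 1" if "p \<in> o(\<lambda>x. 1 / g x)"
    using power_tendsto_1_below_threshold[OF p g bigthetaD1[OF N] that]
    by (rule Lim_transform_eventually) (rule eq)
  show "(\<lambda>x. measure_pmf.prob (random_monomial_ideal (n x) (D x) (p x) :: 'k mpoly set pmf)
      {I. initdeg (n x) I > enat (d x)}) \<longlonglongrightarrow> 0" if "p \<in> \<omega>(\<lambda>x. 1 / g x)"
    using power_tendsto_0_above_threshold[OF p g bigthetaD2[OF N] that]
    by (rule Lim_transform_eventually) (rule eq)
qed

section \<open>The two threshold statements\<close>

theorem theorem4p4:
  shows "(\<forall>(D::nat) (d::nat) (p::nat \<Rightarrow> real).
            1 \<le> d \<and> d \<le> D \<and> (\<forall>n\<ge>1. p n \<in> {0..1}) \<longrightarrow>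
            (p \<in> o(\<lambda>n. 1 / real n ^ d) \<longrightarrow>
              (\<lambda>n. measure_pmf.prob (random_monomial_ideal n D (p n) :: 'k::field mpoly set pmf)
                     {I. initdeg n I > enat d}) \<longlonglongrightarrow> 1) \<and>
            (p \<in> \<omega>(\<lambda>n. 1 / real n ^ d) \<longrightarrow>
              (\<lambda>n. measure_pmf.prob (random_monomial_ideal n D (p n) :: 'k mpoly set pmf)
                     {I. initdeg n I > enat d}) \<longlonglongrightarrow> 0))
       \<and> (\<forall>(n::nat) (d::nat \<Rightarrow> nat) (p::nat \<Rightarrow> real).
            1 \<le> n \<and> (\<forall>D\<ge>1. 1 \<le> d D \<and> d D \<le> D) \<and> filterlim d at_top at_top \<and>
            (\<forall>D\<ge>1. p D \<in> {0..1}) \<longrightarrow>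
            (p \<in> o(\<lambda>D. 1 / real (d D) ^ n) \<longrightarrow>
              (\<lambda>D. measure_pmf.prob (random_monomial_ideal n D (p D) :: 'k mpoly set pmf)
                     {I. initdeg n I > enat (d D)}) \<longlonglongrightarrow> 1) \<and>
            (p \<in> \<omega>(\<lambda>D. 1 / real (d D) ^ n) \<longrightarrow>
              (\<lambda>D. measure_pmf.prob (random_monomial_ideal n D (p D) :: 'k mpoly set pmf)
                     {I. initdeg n I > enat (d D)}) \<longlonglongrightarrow> 0))"
proof (intro conjI allI impI; elim conjE)
  fix D d :: nat and p :: "nat \<Rightarrow> real"
  assume d: "1 \<le> d" "d \<le> D" and p: "\<forall>n\<ge>1. p n \<in> {0..1}"
  \<comment> \<open>Here \<open>d\<close> is fixed, and the count is \<open>(n + d) choose d\<close> read through the symmetry.\<close>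
  have "(\<lambda>n. real (((n + d) choose n) - 1)) \<in> \<Theta>(\<lambda>n. real n ^ d)"
    using binomial_minus_1_bigtheta[OF d(1)] binomial_symmetric[of d "_ + d"] by simp
  note threshold = initdeg_threshold[of "\<lambda>_. d" "\<lambda>_. D" p "\<lambda>n. real n ^ d" "\<lambda>n. n", OF _ _ _ this,
    where ?'k = 'k]
  have ev: "eventually (\<lambda>n. p n \<in> {0..1}) at_top" "eventually (\<lambda>n. real n ^ d \<noteq> 0) at_top"
    using p by (auto intro!: eventually_sequentiallyI[of 1])
  show "(\<lambda>n. measure_pmf.prob (random_monomial_ideal n D (p n) :: 'k mpoly set pmf)
      {I. initdeg n I > enat d}) \<longlonglongrightarrow> 1" if "p \<in> o(\<lambda>n. 1 / real n ^ d)"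
    by (rule threshold(1)[OF _ ev that]) (simp add: d)
  show "(\<lambda>n. measure_pmf.prob (random_monomial_ideal n D (p n) :: 'k mpoly set pmf)
      {I. initdeg n I > enat d}) \<longlonglongrightarrow> 0" if "p \<in> \<omega>(\<lambda>n. 1 / real n ^ d)"
    by (rule threshold(2)[OF _ ev that]) (simp add: d)
next
  fix n :: nat and d :: "nat \<Rightarrow> nat" and p :: "nat \<Rightarrow> real"
  assume n: "1 \<le> n" and d: "\<forall>D\<ge>1. 1 \<le> d D \<and> d D \<le> D" and lim: "filterlim d at_top at_top"
    and p: "\<forall>D\<ge>1. p D \<in> {0..1}"
  \<comment> \<open>The estimate in the growing degree is pulled back along \<open>d\<close>, which tends to infinity.\<close>
  have "(\<lambda>D. real (((n + d D) choose n) - 1)) \<in> \<Theta>(\<lambda>D. real (d D) ^ n)"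
    using landau_theta.compose[OF binomial_minus_1_bigtheta[OF n] lim] by (simp add: add.commute)
  note threshold = initdeg_threshold[of d "\<lambda>D. D" p "\<lambda>D. real (d D) ^ n" "\<lambda>_. n", OF _ _ _ this,
    where ?'k = 'k]
  have ev: "eventually (\<lambda>D. d D \<le> D) at_top" "eventually (\<lambda>D. p D \<in> {0..1}) at_top"
      "eventually (\<lambda>D. real (d D) ^ n \<noteq> 0) at_top"
    using p d by (auto intro!: eventually_sequentiallyI[of 1])
  show "(\<lambda>D. measure_pmf.prob (random_monomial_ideal n D (p D) :: 'k mpoly set pmf)
      {I. initdeg n I > enat (d D)}) \<longlonglongrightarrow> 1" if "p \<in> o(\<lambda>D. 1 / real (d D) ^ n)"
    by (rule threshold(1)[OF ev that])
  show "(\<lambda>D. measure_pmf.prob (random_monomial_ideal n D (p D) :: 'k mpoly set pmf)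
      {I. initdeg n I > enat (d D)}) \<longlonglongrightarrow> 0" if "p \<in> \<omega>(\<lambda>D. 1 / real (d D) ^ n)"
    by (rule threshold(2)[OF ev that])
qed

end
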